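(* Let $(\mathcal G,B)$ be a metric $n$-Lie algebra and $\mathcal G=\mathcal S\oplus\mathcal R$ a Levi decomposition. Then $\mathcal G$ has no (nonzero) strong semisimple ideals if and only if $\mathcal R$ is coisotropic, i.e. $\mathcal R^\bot\subseteq\mathcal R$. Moreover, $$\mathcal C_{\mathcal G}(\mathcal R)=\mathcal C(\mathcal G)\oplus\mathcal R^\bot\quad\text{and}\quad[\mathcal S,\dots,\mathcal S,\mathcal R^\bot]=\mathcal R^\bot.$$
   Context: Fix an integer $n\ge 2$. All $n$-Lie algebras are finite-dimensional over $\mathbb C$. An $n$-Lie algebra is a vector space $\mathcal G$ with an $n$-multilinear bracket satisfying $[x_1,\dots,x_n]=\mathrm{sign}(\sigma)[x_{\sigma(1)},\dots,x_{\sigma(n)}]$ for all $\sigma\in S_n$ and $[[x_1,\dots,x_n],y_2,\dots,y_n]=\sum_{i=1}^n[x_1,\dots,[x_i,y_2,\dots,y_n],\dots,x_n]$. For subspaces $V_1,\dots,V_n$, $[V_1,\dots,V_n]$ is the span of all brackets $[v_1,\dots,v_n]$ with $v_i\in V_i$. A metric $n$-Lie algebra $(\mathcal G,B)$ is an $n$-Lie algebra with a nondegenerate symmetric bilinear form $B$ that is invariant: $B([x_1,\dots,x_{n-1},y_1],y_2)=-B([x_1,\dots,x_{n-1},y_2],y_1)$ for all $x_i,y_j$. For a subspace $W$, $W^\bot=\{x\in\mathcal G: B(w,x)=0\ \forall w\in W\}$. An ideal is a subspace $I$ with $[I,\mathcal G,\dots,\mathcal G]\subseteq I$. $\mathcal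 G$ is simple if $[\mathcal G,\dots,\mathcal G]\ne0$ and its only ideals are $0$ and $\mathcal G$. An $n$-Lie algebra is strong semisimple if it is the direct sum of simple ideals; a strong semisimple ideal is an ideal that is strong semisimple as an $n$-Lie algebra. An ideal $I$ is solvable if $I^{(s)}=0$ for some $s$, where $I^{(0)}=I$, $I^{(s+1)}=[I^{(s)},\dots,I^{(s)}]$; the radical $\mathcal R$ is the maximal solvable ideal. A Levi decomposition is $\mathcal G=\mathcal S\oplus\mathcal R$ (direct sum of subspaces) with $\mathcal R$ the radical and $\mathcal S$ a strong semisimple subalgebra (possibly zero); one always exists. For a subspace $V$, $\mathcal C_{\mathcal G}(V)=\{x\in\mathcal G:[x,V,\mathcal G,\dots,\mathcal G]=0\}$, and $\mathcal C(\mathcal G)=\mathcal C_{\mathcal G}(\mathcal G)$ is the center. *)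

theory Defs
  imports Complex_Main "HOL-Combinatorics.Permutations"
begin

definition direct_sum :: "'a::ab_group_add set \<Rightarrow> 'a set \<Rightarrow> 'a set \<Rightarrow> bool" where
  "direct_sum U V W \<longleftrightarrow> U \<inter> V = {0} \<and> W = {u + v |u v. u \<in> U \<and> v \<in> V}"

text \<open>
  The ground space is a whole type with an explicit complex scalar multiplication.  The
  bracket takes the list of its arguments; only lists of length \<open>n\<close> are ever used, so its
  values on other lists are irrelevant.
\<close>

locale n_lie_algebra = vector_space scale
  for scale :: "complex \<Rightarrow> 'a::ab_group_add \<Rightarrow> 'a" (infixr "*s" 75) +
  fixes n :: nat and br :: "'a list \<Rightarrow> 'a"
  assumes arity: "2 \<le> n"
    and finite_dim: "\<exists>A. finite A \<and> span A = UNIV"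
    and multilinear:
      "\<And>xs i. length xs = n \<Longrightarrow> i < n \<Longrightarrow> Vector_Spaces.linear scale scale (\<lambda>x. br (xs[i := x]))"
    and skew:
      "\<And>xs \<sigma>. length xs = n \<Longrightarrow> \<sigma> permutes {..<n} \<Longrightarrow>
        br xs = of_int (sign \<sigma>) *s br (permute_list \<sigma> xs)"
    and fundamental:
      "\<And>xs ys. length xs = n \<Longrightarrow> length ys = n - 1 \<Longrightarrow>
        br (br xs # ys) = (\<Sum>i<n. br (xs[i := br (xs ! i # ys)]))"
begin

definition bracket_span :: "'a set list \<Rightarrow> 'a set" where
  "bracket_span Vs = span (br ` listset Vs)"

definition subalgebra :: "'a set \<Rightarrow> bool" where
  "subalgebra H \<longleftrightarrow> subspace H \<and> bracket_span (replicate n H) \<subseteq> H"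

text \<open>
  The notions for an algebra in its own right are stated for a subalgebra \<open>H\<close>, so that they
  apply both to the whole algebra (\<open>H = UNIV\<close>) and to its ideals and subalgebras.
\<close>

definition ideal_in :: "'a set \<Rightarrow> 'a set \<Rightarrow> bool" where
  "ideal_in H I \<longleftrightarrow> subspace I \<and> I \<subseteq> H \<and> bracket_span (I # replicate (n - 1) H) \<subseteq> I"

abbreviation ideal :: "'a set \<Rightarrow> bool" where
  "ideal I \<equiv> ideal_in UNIV I"

definition simple :: "'a set \<Rightarrow> bool" where
  "simple H \<longleftrightarrow> bracket_span (replicate n H) \<noteq> {0} \<and>
    (\<forall>I. ideal_in H I \<longrightarrow> I = {0} \<or> I = H)"

text \<open>
  The summands may be collected in a set instead of an indexed family, because simple ideals
  are nonzero and hence no summand of a direct sum is repeated.  The empty sum is allowed: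
  the zero algebra is strong semisimple.
\<close>

definition strong_semisimple :: "'a set \<Rightarrow> bool" where
  "strong_semisimple H \<longleftrightarrow>
    (\<exists>\<J>. finite \<J> \<and> (\<forall>J\<in>\<J>. ideal_in H J \<and> simple J) \<and>
      span (\<Union>\<J>) = H \<and> (\<forall>J\<in>\<J>. J \<inter> span (\<Union>(\<J> - {J})) = {0}))"

primrec derived :: "'a set \<Rightarrow> nat \<Rightarrow> 'a set" where
  "derived I 0 = I"
| "derived I (Suc s) = bracket_span (replicate n (derived I s))"

definition solvable :: "'a set \<Rightarrow> bool" where
  "solvable I \<longleftrightarrow> (\<exists>s. derived I s = {0})"

definition is_radical :: "'a set \<Rightarrow> bool" where
  "is_radical R \<longleftrightarrow> ideal R \<and> solvable R \<and>
    (\<forall>I. ideal I \<and> solvable I \<and> R \<subseteq> I \<longrightarrow> I = R)"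

definition levi_decomposition :: "'a set \<Rightarrow> 'a set \<Rightarrow> bool" where
  "levi_decomposition S R \<longleftrightarrow>
    subalgebra S \<and> strong_semisimple S \<and> is_radical R \<and> direct_sum S R UNIV"

definition centralizer :: "'a set \<Rightarrow> 'a set" where
  "centralizer V = {x. bracket_span ({x} # V # replicate (n - 2) UNIV) = {0}}"

definition center :: "'a set" where
  "center = centralizer UNIV"

end

locale metric_n_lie_algebra = n_lie_algebra scale n br
  for scale :: "complex \<Rightarrow> 'a::ab_group_add \<Rightarrow> 'a" (infixr "*s" 75)
    and n :: nat and br :: "'a list \<Rightarrow> 'a" +
  fixes B :: "'a \<Rightarrow> 'a \<Rightarrow> complex"
  assumes linear_right: "\<And>x. Vector_Spaces.linear scale (*) (B x)"
    and linear_left: "\<And>y. Vector_Spaces.linear scale (*) (\<lambda>x. B x y)"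
    and symmetric: "\<And>x y. B x y = B y x"
    and nondegenerate: "\<And>x. (\<forall>y. B x y = 0) \<Longrightarrow> x = 0"
    and invariant:
      "\<And>xs y z. length xs = n - 1 \<Longrightarrow> B (br (xs @ [y])) z = - B (br (xs @ [z])) y"

definition orth :: "('a \<Rightarrow> 'a \<Rightarrow> complex) \<Rightarrow> 'a set \<Rightarrow> 'a set" where
  "orth B W = {x. \<forall>w\<in>W. B w x = 0}"

end

theory Submission imports Defs begin

text \<open>
  The orthogonal space of an ideal is an ideal that centralises it, and orthogonality is
  an involution on subspaces because \<open>B\<close> is nondegenerate.  Both equalities are therefore checked
  on orthogonal spaces.  The centralizer of \<open>R\<close> is the orthogonal space of \<open>T = [R, G, \<dots>, G]\<close>;
  since \<open>S = [S, \<dots>, S]\<close>, the derived algebra is \<open>S + T\<close>, so \<open>T = [G, \<dots>, G] \<inter> R\<close> and its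
  orthogonal space is the sum of the center and \<open>R\<^sup>\<bottom>\<close>.  An element orthogonal to
  \<open>[S, \<dots>, S, R\<^sup>\<bottom>]\<close> has an \<open>S\<close>-component that is central in \<open>S\<close>, hence \<open>0\<close>.

  A strong semisimple ideal meets \<open>R\<close> trivially, so it centralises \<open>R\<close>; being perfect, it then
  lies in \<open>R\<^sup>\<bottom>\<close>.  Conversely, if \<open>R\<^sup>\<bottom>\<close> is not contained in \<open>R\<close>, some maximal ideal \<open>H\<close> that
  contains \<open>R\<close>, the sum of \<open>R\<close> and all but one of the simple summands of \<open>S\<close>, does not contain
  \<open>R\<^sup>\<bottom>\<close>.  Then \<open>H\<^sup>\<bottom>\<close> is a minimal ideal outside \<open>R\<close>, hence not abelian, hence
  nondegenerate, and so it is a simple direct summand.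
\<close>

section \<open>Argument lists and sums of subspaces\<close>

lemma listset_iff: "xs \<in> listset Vs \<longleftrightarrow> list_all2 (\<in>) xs Vs"
  by (induction Vs arbitrary: xs) (auto simp: set_Cons_def list_all2_Cons2)

lemma list_all2_mem_replicate: "list_all2 (\<in>) xs (replicate k V) \<longleftrightarrow> length xs = k \<and> set xs \<subseteq> V"
  by (induction k arbitrary: xs) (auto simp: list_all2_Cons2 length_Suc_conv)

text \<open>Serves the bracket of \<open>S, ..., S, orth B R\<close>, whose exceptional entry stands
  in the last slot.\<close>

lemma list_all2_snoc:
  "list_all2 P xs (Vs @ [V]) \<longleftrightarrow> (\<exists>ys y. xs = ys @ [y] \<and> list_all2 P ys Vs \<and> P y V)"
proof (cases xs rule: rev_cases)
  case (snoc ys y)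
  have "list_all2 P (ys @ [y]) (Vs @ [V]) \<longleftrightarrow> list_all2 P (y # rev ys) (V # rev Vs)"
    using list_all2_rev[of P "ys @ [y]" "Vs @ [V]"] by simp
  then show ?thesis using snoc by auto
qed simp

lemma (in vector_space) span_Union_sum:
  assumes "finite \<J>" "\<And>J. J \<in> \<J> \<Longrightarrow> subspace J" "x \<in> span (\<Union>\<J>)"
  obtains f where "\<And>J. J \<in> \<J> \<Longrightarrow> f J \<in> J" "x = (\<Sum>J\<in>\<J>. f J)"
proof -
  have "\<exists>f. (\<forall>J\<in>\<J>. f J \<in> J) \<and> x = (\<Sum>J\<in>\<J>. f J)"
    using assms
  proof (induction \<J> arbitrary: x rule: finite_induct)
    case empty
    then show ?case by simp
  next
    case (insert J \<J>)
    have "span J = J" using insert.prems(1) by simp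
    with insert.prems(2) obtain u v where uv: "u \<in> J" "v \<in> span (\<Union>\<J>)" "x = u + v"
      unfolding Union_insert span_Un by auto
    with insert obtain f where f: "\<forall>J\<in>\<J>. f J \<in> J" "v = (\<Sum>J\<in>\<J>. f J)"
      by (metis insertI2)
    have "(\<Sum>K\<in>\<J>. (f(J := u)) K) = v"
      unfolding f(2) using insert.hyps by (intro sum.cong) auto
    then have "x = (\<Sum>K\<in>insert J \<J>. (f(J := u)) K)"
      using insert.hyps uv by simp
    then show ?case using f uv by (intro exI[of _ "f(J := u)"]) auto
  qed
  then show thesis using that by blast
qed

text \<open>Write \<open>x\<close> as a sum of components \<open>f J\<close>. If \<open>x\<close>
  lies in the span of the members other than \<open>J\<close>, then so does \<open>f J\<close>, and
  independence makes it vanish. This allows an element to be shown zero by looking at one summand at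
  a time.\<close>

lemma (in vector_space) independent_family_Int:
  assumes fin: "finite \<J>" and sub: "\<And>J. J \<in> \<J> \<Longrightarrow> subspace J"
    and indep: "\<And>J. J \<in> \<J> \<Longrightarrow> J \<inter> span (\<Union>(\<J> - {J})) = {0}"
    and x: "x \<in> span (\<Union>\<J>)" "\<And>J. J \<in> \<J> \<Longrightarrow> x \<in> span (\<Union>(\<J> - {J}))"
  shows "x = 0"
proof -
  obtain f where f: "\<And>J. J \<in> \<J> \<Longrightarrow> f J \<in> J" "x = (\<Sum>J\<in>\<J>. f J)"
    using span_Union_sum[OF fin sub x(1)] by blast
  have "f J = 0" if J: "J \<in> \<J>" for J
  proof -
    have "f J = x - (\<Sum>K\<in>\<J> - {J}. f K)"
      using f(2) fin J by (simp add: sum.remove)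
    moreover have "(\<Sum>K\<in>\<J> - {J}. f K) \<in> span (\<Union>(\<J> - {J}))"
      using f(1) by (intro span_sum span_base) auto
    ultimately have "f J \<in> span (\<Union>(\<J> - {J}))"
      using x(2)[OF J] by (simp add: span_diff)
    then show ?thesis using indep[OF J] f(1)[OF J] by blast
  qed
  then show ?thesis using f(2) by simp
qed

section \<open>Brackets, ideals and centralizers\<close>

context n_lie_algebra
begin

lemma module_hom_br:
  assumes "length ps + length qs = n - 1"
  shows "module_hom scale scale (\<lambda>x. br (ps @ x # qs))"
proof -
  \<comment> \<open>The entry \<open>0\<close> is a placeholder at position
    \<open>length ps\<close>, which the list update overwrites.\<close>
  have "Vector_Spaces.linear scale scale (\<lambda>x. br ((ps @ 0 # qs)[length ps := x]))"
    using assms arity by (intro multilinear) auto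
  then show ?thesis by (simp add: module_hom_iff_linear)
qed

lemma module_hom_br_head: "length qs = n - 1 \<Longrightarrow> module_hom scale scale (\<lambda>x. br (x # qs))"
  using module_hom_br[of "[]"] by simp

text \<open>Skew-symmetry reduced to what the later arguments need: vanishing and membership in a
  subspace ignore signs, so only the multiset of arguments matters and no permutation has to be
  named.\<close>

lemma br_mset:
  assumes "length xs = n" "mset xs = mset ys"
  shows "br xs = br ys \<or> br xs = - br ys"
proof -
  from assms(2) obtain \<sigma> where \<sigma>: "\<sigma> permutes {..<length xs}" "permute_list \<sigma> xs = ys"
    using mset_eq_permutation by metis
  with skew[OF assms(1)] assms(1) have "br xs = of_int (sign \<sigma>) *s br ys" by metis
  then show ?thesis by (auto simp: sign_def)
qed

lemma br_mset_mem:
  assumes "length xs = n" "mset xs = mset ys" "subspace V" "br ys \<in> V"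
  shows "br xs \<in> V"
  using br_mset[OF assms(1,2)] assms(3,4) subspace_neg by auto

lemma bracket_span_subset_iff:
  "subspace W \<Longrightarrow> bracket_span Vs \<subseteq> W \<longleftrightarrow> (\<forall>xs. list_all2 (\<in>) xs Vs \<longrightarrow> br xs \<in> W)"
  unfolding bracket_span_def
  by (metis (no_types, lifting) image_subset_iff listset_iff span_minimal span_superset subset_trans)

lemma subspace_bracket_span [simp]: "subspace (bracket_span Vs)"
  by (simp add: bracket_span_def)

lemma br_mem_bracket_span: "list_all2 (\<in>) xs Vs \<Longrightarrow> br xs \<in> bracket_span Vs"
  by (simp add: bracket_span_def listset_iff span_base)

lemma bracket_span_replicate_subset_iff:
  "subspace W \<Longrightarrow> bracket_span (replicate n H) \<subseteq> W \<longleftrightarrow>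
    (\<forall>xs. length xs = n \<longrightarrow> set xs \<subseteq> H \<longrightarrow> br xs \<in> W)"
  by (auto simp: bracket_span_subset_iff list_all2_mem_replicate)

lemma bracket_span_mono: "H \<subseteq> K \<Longrightarrow> bracket_span (replicate n H) \<subseteq> bracket_span (replicate n K)"
  by (subst bracket_span_replicate_subset_iff)
     (auto intro!: br_mem_bracket_span simp: list_all2_mem_replicate)

lemma bracket_span_Cons_subset_iff:
  "subspace W \<Longrightarrow> bracket_span (I # replicate k H) \<subseteq> W \<longleftrightarrow>
    (\<forall>x ys. x \<in> I \<longrightarrow> length ys = k \<longrightarrow> set ys \<subseteq> H \<longrightarrow> br (x # ys) \<in> W)"
  by (auto simp: bracket_span_subset_iff list_all2_mem_replicate list_all2_Cons2)

lemma ideal_in_iff: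
  "ideal_in H I \<longleftrightarrow> subspace I \<and> I \<subseteq> H \<and>
    (\<forall>x ys. x \<in> I \<longrightarrow> length ys = n - 1 \<longrightarrow> set ys \<subseteq> H \<longrightarrow> br (x # ys) \<in> I)"
  unfolding ideal_in_def using bracket_span_Cons_subset_iff by blast

lemma ideal_in_subspace: "ideal_in H I \<Longrightarrow> subspace I"
  by (simp add: ideal_in_def)

text \<open>Ideals are defined through the first slot. A member in another slot is moved to the
  front, which changes the bracket at most by a sign.\<close>

lemma ideal_in_br:
  assumes "ideal_in H I" "length xs = n" "set xs \<subseteq> H" "set xs \<inter> I \<noteq> {}"
  shows "br xs \<in> I"
proof -
  obtain x where x: "x \<in> set xs" "x \<in> I" using assms by blast
  show ?thesis
  proof (rule br_mset_mem[OF assms(2) _ ideal_in_subspace[OF assms(1)]])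
    show "mset xs = mset (x # remove1 x xs)" using x by simp
    show "br (x # remove1 x xs) \<in> I"
      using assms x set_remove1_subset[of x xs] unfolding ideal_in_iff
      by (auto simp: length_remove1)
  qed
qed

lemma ideal_in_self:
  assumes "ideal_in H J" shows "ideal_in J J"
  using assms unfolding ideal_in_iff by blast

text \<open>Two ambient algebras are allowed because an ideal of the whole algebra is later
  intersected with a simple summand of \<open>S\<close>, which is known to be an ideal only in
  \<open>S\<close>.\<close>

lemma ideal_Int:
  assumes "ideal_in H I" "ideal_in K J" "J \<subseteq> H"
  shows "ideal_in J (I \<inter> J)"
  using assms ideal_in_self[OF assms(2)] unfolding ideal_in_iff by (blast intro: subspace_inter)

lemma ideal_in_sum:
  assumes "ideal_in H I" "ideal_in H J" "subspace H"
  shows "ideal_in H {x + y |x y. x \<in> I \<and> y \<in> J}"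
  unfolding ideal_in_iff
proof (intro conjI allI impI)
  show "subspace {x + y |x y. x \<in> I \<and> y \<in> J}"
    using assms by (intro subspace_sums) (auto dest: ideal_in_subspace)
next
  fix z ys assume z: "z \<in> {x + y |x y. x \<in> I \<and> y \<in> J}" and ys: "length ys = n - 1" "set ys \<subseteq> H"
  from z obtain x y where "x \<in> I" "y \<in> J" "z = x + y" by blast
  moreover from this have "br (z # ys) = br (x # ys) + br (y # ys)"
    using module_hom.add[OF module_hom_br_head[OF ys(1)]] by simp
  ultimately show "br (z # ys) \<in> {x + y |x y. x \<in> I \<and> y \<in> J}"
    using assms ys unfolding ideal_in_iff by blast
next
  show "{x + y |x y. x \<in> I \<and> y \<in> J} \<subseteq> H"
    using assms by (auto simp: ideal_in_def intro!: subspace_add)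
qed

text \<open>Multilinear expansion with the prefix \<open>xs\<close> kept fixed. Entries are split
  from left to right; a term that picks up an entry from \<open>D\<close> is settled at once by
  \<open>bad\<close>, with the entries after it still unexpanded, so that only the term with all
  entries in \<open>A\<close> remains for \<open>good\<close>.\<close>

lemma br_sum_expand:
  assumes V: "subspace V"
    and good: "\<And>ps. length (xs @ ps) = n \<Longrightarrow> set ps \<subseteq> A \<Longrightarrow> br (xs @ ps) \<in> V"
    and bad: "\<And>ps. length (xs @ ps) = n \<Longrightarrow> set ps \<inter> D \<noteq> {} \<Longrightarrow> br (xs @ ps) \<in> V"
    and qs: "set qs \<subseteq> {a + d |a d. a \<in> A \<and> d \<in> D}"
    and len: "length (xs @ qs) = n"
  shows "br (xs @ qs) \<in> V"
proof -
  \<comment> \<open>The induction needs \<open>ps\<close>, the entries already replaced by their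
    \<open>A\<close>-components.\<close>
  have "br (xs @ ps @ qs) \<in> V" if "set ps \<subseteq> A" "length (xs @ ps @ qs) = n" for ps
    using that qs
  proof (induction qs arbitrary: ps)
    case Nil
    then show ?case using good by simp
  next
    case (Cons q qs)
    then obtain a d where ad: "a \<in> A" "d \<in> D" "q = a + d" by auto
    have "br (xs @ ps @ q # qs) = br (xs @ ps @ a # qs) + br (xs @ ps @ d # qs)"
      using module_hom.add[OF module_hom_br[of "xs @ ps" qs]] Cons.prems(2) by (simp add: ad(3))
    moreover have "br (xs @ (ps @ [a]) @ qs) \<in> V"
      using Cons.prems ad by (intro Cons.IH) auto
    moreover have "br (xs @ ps @ d # qs) \<in> V"
      using Cons.prems ad by (intro bad) auto
    ultimately show ?case using V by (simp add: subspace_add)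
  qed
  from this[of "[]"] len show ?thesis by simp
qed

lemma centralizer_iff:
  "x \<in> centralizer V \<longleftrightarrow> (\<forall>v zs. v \<in> V \<longrightarrow> length zs = n - 2 \<longrightarrow> br (x # v # zs) = 0)"
proof -
  have "x \<in> centralizer V \<longleftrightarrow> bracket_span ({x} # V # replicate (n - 2) UNIV) \<subseteq> {0}"
    using subspace_0[OF subspace_bracket_span] unfolding centralizer_def by blast
  also have "\<dots> \<longleftrightarrow> (\<forall>v zs. v \<in> V \<longrightarrow> length zs = n - 2 \<longrightarrow> br (x # v # zs) = 0)"
    by (auto simp: bracket_span_subset_iff list_all2_Cons2 list_all2_mem_replicate)
  finally show ?thesis .
qed

lemma center_iff: "x \<in> center \<longleftrightarrow> (\<forall>ys. length ys = n - 1 \<longrightarrow> br (x # ys) = 0)"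
proof -
  have "n - 1 = Suc (n - 2)" using arity by simp
  then show ?thesis
    unfolding center_def centralizer_iff by (auto simp: length_Suc_conv)
qed

lemma subspace_centralizer: "subspace (centralizer V)"
proof -
  have "centralizer V = (\<Inter>v\<in>V. \<Inter>zs\<in>{zs. length zs = n - 2}. {x. br (x # v # zs) = 0})"
    by (auto simp: centralizer_iff)
  moreover have "subspace {x. br (x # v # zs) = 0}" if "length zs = n - 2" for v zs
    using that arity by (intro module_hom.subspace_kernel[OF module_hom_br_head]) simp
  ultimately show ?thesis by (auto intro!: subspace_Int)
qed

section \<open>Solvability and the radical\<close>

lemma derived_mono: "H \<subseteq> K \<Longrightarrow> derived H s \<subseteq> derived K s"
  by (induction s) (auto dest: bracket_span_mono)

text \<open>The definition splits off the last bracket step; splitting off the first one lets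
  solvability pass from the derived algebra of \<open>H\<close> back to \<open>H\<close>.\<close>

lemma derived_Suc: "derived H (Suc s) = derived (bracket_span (replicate n H)) s"
  by (induction s) simp_all

lemma subspace_derived: "subspace H \<Longrightarrow> subspace (derived H s)"
  by (cases s) simp_all

text \<open>Solvability asks for a term equal to \<open>{0}\<close>; that \<open>H\<close> is a
  subspace puts \<open>0\<close> into each of its derived terms.\<close>

lemma solvable_subset:
  assumes "solvable K" "H \<subseteq> K" "subspace H" shows "solvable H"
  using assms derived_mono[OF assms(2)] subspace_derived[OF assms(3)] subspace_0
  unfolding solvable_def by fastforce

text \<open>Brackets of \<open>M + R\<close> expand into brackets inside \<open>M\<close>, which
  vanish, and brackets with an entry in \<open>R\<close>, which stay in \<open>R\<close>. So the
  derived algebra of \<open>M + R\<close> is solvable, hence so is \<open>M + R\<close>, and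
  maximality of \<open>R\<close> gives \<open>M + R = R\<close>.\<close>

lemma abelian_ideal_subset_radical:
  assumes R: "is_radical R" and M: "ideal M" and ab: "bracket_span (replicate n M) = {0}"
  shows "M \<subseteq> R"
proof -
  let ?I = "{x + y |x y. x \<in> M \<and> y \<in> R}"
  have iR: "ideal R" using R by (simp add: is_radical_def)
  have sub: "subspace R" "subspace M" using iR M by (simp_all add: ideal_in_subspace)
  have I: "ideal ?I" by (rule ideal_in_sum[OF M iR subspace_UNIV])
  have "bracket_span (replicate n ?I) \<subseteq> R"
  proof (subst bracket_span_replicate_subset_iff[OF sub(1)], intro allI impI)
    fix xs assume "length xs = n" "set xs \<subseteq> ?I"
    then show "br xs \<in> R"
      using br_sum_expand[OF sub(1), of "[]" M R xs] ideal_in_br[OF iR] subspace_0[OF sub(1)]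
        ab bracket_span_replicate_subset_iff[of "{0}" M] by auto
  qed
  then have "solvable (bracket_span (replicate n ?I))"
    using R unfolding is_radical_def by (blast intro: solvable_subset subspace_bracket_span)
  then have "solvable ?I" unfolding solvable_def derived_Suc[symmetric] by blast
  moreover have "R \<subseteq> ?I"
  proof
    fix x assume "x \<in> R"
    then show "x \<in> ?I" using subspace_0[OF sub(2)] by (intro CollectI exI[of _ 0] exI[of _ x]) simp
  qed
  ultimately have "?I = R" using R I unfolding is_radical_def by blast
  moreover have "M \<subseteq> ?I"
  proof
    fix x assume "x \<in> M"
    then show "x \<in> ?I" using subspace_0[OF sub(1)] by (intro CollectI exI[of _ x] exI[of _ 0]) simp
  qed
  ultimately show ?thesis by simp
qed

section \<open>Simple and strong semisimple algebras\<close>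

text \<open>The derived algebra is an ideal of \<open>J\<close>, and simplicity includes that it is
  nonzero.\<close>

lemma simple_perfect:
  assumes "ideal_in H J" "simple J"
  shows "bracket_span (replicate n J) = J"
proof -
  have J: "ideal_in J J" using assms(1) by (rule ideal_in_self)
  have sub: "bracket_span (replicate n J) \<subseteq> J"
  proof (subst bracket_span_replicate_subset_iff[OF ideal_in_subspace[OF J]], intro allI impI)
    fix xs assume "length xs = n" "set xs \<subseteq> J"
    moreover from this arity have "set xs \<inter> J \<noteq> {}" by (cases xs) auto
    ultimately show "br xs \<in> J" using ideal_in_br[OF J] by simp
  qed
  then have "ideal_in J (bracket_span (replicate n J))"
    unfolding ideal_in_iff
    using arity by (auto intro!: br_mem_bracket_span simp: list_all2_mem_replicate)
  then show ?thesis using assms(2) unfolding simple_def by blast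
qed

lemma simple_center:
  assumes J: "ideal_in H J" "simple J" and x: "x \<in> J"
    and ann: "\<And>ys. length ys = n - 1 \<Longrightarrow> set ys \<subseteq> J \<Longrightarrow> br (x # ys) = 0"
  shows "x = 0"
proof -
  have sub: "subspace J" using J(1) by (rule ideal_in_subspace)
  \<comment> \<open>The center of \<open>J\<close> as an algebra in its own right, written as an
    intersection of kernels. It is an ideal of \<open>J\<close>, and it cannot be all of
    \<open>J\<close> because brackets in \<open>J\<close> do not all vanish.\<close>
  let ?Z = "J \<inter> (\<Inter>ys\<in>{ys. length ys = n - 1 \<and> set ys \<subseteq> J}. {x. br (x # ys) = 0})"
  have "subspace ?Z"
    using module_hom.subspace_kernel[OF module_hom_br_head]
    by (intro subspace_inter[OF sub] subspace_Int) auto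
  moreover have "0 \<in> ?Z" using calculation by (rule subspace_0)
  ultimately have "ideal_in J ?Z" unfolding ideal_in_iff by auto
  moreover have "?Z \<noteq> J"
  proof
    assume Z: "?Z = J"
    have "br xs = 0" if xs: "length xs = n" "set xs \<subseteq> J" for xs
    proof -
      obtain y ys where "xs = y # ys" using xs arity by (cases xs) auto
      moreover from this xs have "y \<in> ?Z" unfolding Z by simp
      ultimately show ?thesis using xs by auto
    qed
    then have "bracket_span (replicate n J) \<subseteq> {0}"
      by (subst bracket_span_replicate_subset_iff) auto
    then show False
      using J(2) subspace_0[OF subspace_bracket_span] unfolding simple_def by blast
  qed
  ultimately have "?Z = {0}" using J(2) unfolding simple_def by blast
  then show ?thesis using x ann by auto
qed

lemma ideal_in_span_Union:
  assumes "\<And>J. J \<in> \<J> \<Longrightarrow> ideal_in H J" "subspace H"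
  shows "ideal_in H (span (\<Union>\<J>))"
proof -
  have "br (x # ys) \<in> span (\<Union>\<J>)"
    if "x \<in> span (\<Union>\<J>)" and ys: "length ys = n - 1" "set ys \<subseteq> H" for x ys
  proof -
    have "span (\<Union>\<J>) \<subseteq> {x. br (x # ys) \<in> span (\<Union>\<J>)}"
    proof (rule span_minimal)
      show "subspace {x. br (x # ys) \<in> span (\<Union>\<J>)}"
        by (intro module_hom.subspace_linear_preimage[OF module_hom_br_head[OF ys(1)]]) simp
      show "\<Union>\<J> \<subseteq> {x. br (x # ys) \<in> span (\<Union>\<J>)}"
        using assms(1) ys unfolding ideal_in_iff by (blast intro: span_base)
    qed
    with that show ?thesis by blast
  qed
  moreover have "span (\<Union>\<J>) \<subseteq> H"
    using assms by (intro span_minimal) (auto simp: ideal_in_def)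
  ultimately show ?thesis unfolding ideal_in_iff by blast
qed

text \<open>Names the witness inside \<open>strong_semisimple\<close>, so that one fixed
  decomposition can be shared between lemmas.\<close>

definition simple_summands :: "'a set set \<Rightarrow> 'a set \<Rightarrow> bool" where
  "simple_summands \<J> H \<longleftrightarrow> finite \<J> \<and> (\<forall>J\<in>\<J>. ideal_in H J \<and> simple J) \<and>
      span (\<Union>\<J>) = H \<and> (\<forall>J\<in>\<J>. J \<inter> span (\<Union>(\<J> - {J})) = {0})"

lemma strong_semisimple_iff: "strong_semisimple H \<longleftrightarrow> (\<exists>\<J>. simple_summands \<J> H)"
  by (simp add: strong_semisimple_def simple_summands_def)

lemma simple_summands_Int:
  assumes "simple_summands \<J> H" "x \<in> H" "\<And>J. J \<in> \<J> \<Longrightarrow> x \<in> span (\<Union>(\<J> - {J}))"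
  shows "x = 0"
  using assms unfolding simple_summands_def
  by (intro independent_family_Int[of \<J> x]) (auto simp: ideal_in_def)

text \<open>Split \<open>x = u + v\<close> with \<open>u\<close> in \<open>J\<close> and
  \<open>v\<close> in the sum \<open>?K\<close> of the other summands. Brackets of \<open>v\<close>
  with \<open>J\<close> fall into \<open>J \<inter> ?K\<close>, which is zero, so \<open>u\<close>
  is central in \<open>J\<close> and vanishes. Thus \<open>x\<close> lies in \<open>?K\<close> for
  every \<open>J\<close>.\<close>

lemma simple_summands_center:
  assumes \<J>: "simple_summands \<J> H" and x: "x \<in> H"
    and ann: "\<And>J ys. J \<in> \<J> \<Longrightarrow> length ys = n - 1 \<Longrightarrow> set ys \<subseteq> J \<Longrightarrow> br (x # ys) = 0"
  shows "x = 0"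
proof (rule simple_summands_Int[OF \<J> x])
  fix J assume J: "J \<in> \<J>"
  let ?K = "span (\<Union>(\<J> - {J}))"
  have iJ: "ideal_in H J" "simple J" using \<J> J by (auto simp: simple_summands_def)
  have H: "subspace H" using \<J> by (auto simp: simple_summands_def)
  have iK: "ideal_in H ?K"
    using \<J> by (intro ideal_in_span_Union[OF _ H]) (auto simp: simple_summands_def)
  have "\<Union>\<J> = J \<union> \<Union>(\<J> - {J})" using J by blast
  then have "x \<in> span (J \<union> \<Union>(\<J> - {J}))"
    using x \<J> by (simp add: simple_summands_def)
  moreover have "span J = J" using ideal_in_subspace[OF iJ(1)] by simp
  ultimately obtain u v where uv: "u \<in> J" "v \<in> ?K" "x = u + v"
    unfolding span_Un by auto
  have "u = 0"
  proof (rule simple_center[OF iJ uv(1)])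
    fix ys assume ys: "length ys = n - 1" "set ys \<subseteq> J"
    have len: "length (v # ys) = n" using ys arity by simp
    have sub: "set (v # ys) \<subseteq> H" using iJ(1) iK uv ys by (auto simp: ideal_in_def)
    \<comment> \<open>Since \<open>n\<close> is at least 2, \<open>ys\<close> is nonempty and
      supplies an entry from \<open>J\<close>.\<close>
    have "set (v # ys) \<inter> J \<noteq> {}" using ys arity by (cases ys) auto
    then have "br (v # ys) \<in> J \<inter> ?K"
      using ideal_in_br[OF iJ(1) len sub] ideal_in_br[OF iK len sub] uv(2) by auto
    then have "br (v # ys) = 0" using \<J> J by (auto simp: simple_summands_def)
    then show "br (u # ys) = 0"
      using ann[OF J ys] module_hom.add[OF module_hom_br_head[OF ys(1)], of u v] uv(3) by simp
  qed
  then show "x \<in> ?K" using uv by simp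
qed

lemma strong_semisimple_center:
  assumes "strong_semisimple H" "x \<in> H"
    and "\<And>ys. length ys = n - 1 \<Longrightarrow> set ys \<subseteq> H \<Longrightarrow> br (x # ys) = 0"
  shows "x = 0"
proof -
  obtain \<J> where \<J>: "simple_summands \<J> H" using assms(1) strong_semisimple_iff by blast
  show ?thesis
  proof (rule simple_summands_center[OF \<J> assms(2)])
    fix J ys assume "J \<in> \<J>" "length ys = n - 1" "set ys \<subseteq> J"
    moreover from this \<J> have "J \<subseteq> H" by (auto simp: simple_summands_def ideal_in_def)
    ultimately show "br (x # ys) = 0" using assms(3) by blast
  qed
qed

lemma strong_semisimple_subset_derived:
  assumes "strong_semisimple H" shows "H \<subseteq> bracket_span (replicate n H)"
proof -
  obtain \<J> where \<J>: "simple_summands \<J> H" using assms(1) strong_semisimple_iff by blast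
  have "J \<subseteq> bracket_span (replicate n H)" if "J \<in> \<J>" for J
    using \<J> that simple_perfect[of H J] bracket_span_mono[of J H]
    by (auto simp: simple_summands_def ideal_in_def)
  then have "span (\<Union>\<J>) \<subseteq> bracket_span (replicate n H)"
    by (intro span_minimal) auto
  then show ?thesis using \<J> by (simp add: simple_summands_def)
qed

text \<open>A simple summand \<open>J\<close> is perfect, so its derived series is constant and
  \<open>K\<close> cannot contain \<open>J\<close>; hence \<open>K \<inter> J\<close> is zero.
  Brackets of \<open>K\<close> with \<open>J\<close> lie in this intersection, so elements of
  \<open>K\<close> annihilate every summand.\<close>

lemma strong_semisimple_solvable_ideal:
  assumes "strong_semisimple H" and K: "ideal_in H K" "solvable K"
  shows "K = {0}"
proof -
  obtain \<J> where \<J>: "simple_summands \<J> H" using assms(1) strong_semisimple_iff by blast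
  have trivial: "K \<inter> J = {0}" if "J \<in> \<J>" for J
  proof (rule ccontr)
    assume ne: "K \<inter> J \<noteq> {0}"
    have J: "ideal_in H J" "simple J" using \<J> that by (auto simp: simple_summands_def)
    have "ideal_in J (K \<inter> J)" using J by (intro ideal_Int[OF K(1) J(1)]) (auto simp: ideal_in_def)
    then have "J \<subseteq> K" using J(2) ne unfolding simple_def by blast
    then have "solvable J" using K(2) ideal_in_subspace[OF J(1)] solvable_subset by blast
    moreover have "derived J s = J" for s
      by (induction s) (simp_all add: simple_perfect[OF J])
    ultimately have "J = {0}" by (simp add: solvable_def)
    then show False using J(2) simple_perfect[OF J] by (simp add: simple_def)
  qed
  have sub: "K \<subseteq> H" using K(1) by (simp add: ideal_in_def)
  have "x = 0" if x: "x \<in> K" for x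
  proof (rule simple_summands_center[OF \<J>])
    show "x \<in> H" using x sub by blast
    fix J ys assume J: "J \<in> \<J>" and ys: "length ys = n - 1" "set ys \<subseteq> J"
    have iJ: "ideal_in H J" using \<J> J by (auto simp: simple_summands_def)
    have len: "length (x # ys) = n" using ys arity by simp
    have subH: "set (x # ys) \<subseteq> H" using iJ sub x ys by (auto simp: ideal_in_def)
    have "set (x # ys) \<inter> J \<noteq> {}" using ys arity by (cases ys) auto
    then have "br (x # ys) \<in> K \<inter> J"
      using ideal_in_br[OF iJ len subH] ideal_in_br[OF K(1) len subH] x by auto
    then show "br (x # ys) = 0" using trivial[OF J] by blast
  qed
  then show ?thesis using subspace_0[OF ideal_in_subspace[OF K(1)]] by blast
qed

lemma simple_imp_strong_semisimple:
  assumes "ideal_in H M" "simple M" shows "strong_semisimple M"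
proof -
  have "simple_summands {M} M"
    using assms ideal_in_self[OF assms(1)] ideal_in_subspace[OF assms(1)]
    by (auto simp: simple_summands_def subspace_0)
  then show ?thesis using strong_semisimple_iff by blast
qed

end

section \<open>The bilinear form and orthogonal spaces\<close>

context metric_n_lie_algebra
begin

lemma module_hom_B_right: "module_hom scale (*) (B x)"
  using linear_right by (simp add: module_hom_iff_linear)

lemma module_hom_B_left: "module_hom scale (*) (\<lambda>x. B x y)"
  using linear_left by (simp add: module_hom_iff_linear)

lemmas B_simps =
  module_hom.add[OF module_hom_B_right] module_hom.diff[OF module_hom_B_right]
  module_hom.scale[OF module_hom_B_right] module_hom.zero[OF module_hom_B_right]
  module_hom.add[OF module_hom_B_left] module_hom.diff[OF module_hom_B_left]
  module_hom.scale[OF module_hom_B_left] module_hom.zero[OF module_hom_B_left]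

lemma subspace_orth [simp]: "subspace (orth B W)"
  by (rule subspaceI) (auto simp: orth_def B_simps)

lemma orth_antimono: "V \<subseteq> W \<Longrightarrow> orth B W \<subseteq> orth B V"
  by (auto simp: orth_def)

text \<open>Duality for finitely many functionals: if \<open>B x\<close> vanishes on the common
  kernel of the \<open>B a\<close>, it is a combination of them, and nondegeneracy carries this over
  to \<open>x\<close>.\<close>

lemma mem_spanI_B:
  assumes "finite A" "\<And>y. (\<And>a. a \<in> A \<Longrightarrow> B a y = 0) \<Longrightarrow> B x y = 0"
  shows "x \<in> span A"
  using assms
proof (induction A arbitrary: x rule: finite_induct)
  case empty
  then show ?case using nondegenerate by simp
next
  case (insert a A)
  show ?case
  proof (cases "\<exists>z. (\<forall>b\<in>A. B b z = 0) \<and> B a z \<noteq> 0")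
    case True
    then obtain z where z: "\<And>b. b \<in> A \<Longrightarrow> B b z = 0" "B a z \<noteq> 0" by blast
    \<comment> \<open>The coefficient makes the corrected functional vanish at
      \<open>z\<close>.\<close>
    have "x - (B x z / B a z) *s a \<in> span A"
    proof (rule insert.IH)
      fix y assume y: "\<And>b. b \<in> A \<Longrightarrow> B b y = 0"
      \<comment> \<open>Moving \<open>y\<close> along \<open>z\<close> brings it into the kernel of
        \<open>B a\<close> and keeps it in the kernels for \<open>A\<close>.\<close>
      have "B x (y - (B a y / B a z) *s z) = 0"
        using y z by (intro insert.prems) (auto simp: B_simps)
      then show "B (x - (B x z / B a z) *s a) y = 0"
        using z(2) by (simp add: B_simps field_simps)
    qed
    then show ?thesis using span_breakdown_eq by blast
  next
    case False
    then have "x \<in> span A" by (intro insert.IH insert.prems) auto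
    then show ?thesis using span_mono[of A "insert a A"] by blast
  qed
qed

text \<open>Finite dimension enters here: it makes a basis of \<open>W\<close> finite, as
  \<open>mem_spanI_B\<close> requires.\<close>

lemma orth_orth:
  assumes "subspace W" shows "orth B (orth B W) = W"
proof
  obtain A where A: "A \<subseteq> W" "independent A" "W \<subseteq> span A"
    using maximal_independent_subset by blast
  obtain T where "finite T" "span T = UNIV" using finite_dim by blast
  then have finA: "finite A" using independent_span_bound[of T A] A(2) by simp
  have spanA: "span A = W" using A assms by (intro span_subspace)
  show "orth B (orth B W) \<subseteq> W"
  proof
    fix x assume x: "x \<in> orth B (orth B W)"
    have "x \<in> span A"
    proof (rule mem_spanI_B[OF finA])
      fix y assume y: "\<And>a. a \<in> A \<Longrightarrow> B a y = 0"
      have "span A \<subseteq> {w. B w y = 0}"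
        using y module_hom.subspace_kernel[OF module_hom_B_left] by (intro span_minimal) auto
      then have "y \<in> orth B W" using spanA by (auto simp: orth_def)
      then have "B y x = 0" using x by (simp add: orth_def)
      then show "B x y = 0" by (simp add: symmetric)
    qed
    then show "x \<in> W" using spanA by simp
  qed
  show "W \<subseteq> orth B (orth B W)" by (auto simp: orth_def symmetric)
qed

lemma orth_subset_iff:
  assumes "subspace V" "subspace W" shows "orth B V \<subseteq> W \<longleftrightarrow> orth B W \<subseteq> V"
  using orth_antimono[of "orth B V" W] orth_antimono[of "orth B W" V] assms
  by (auto simp: orth_orth)

lemma orth_zero: "orth B {0} = UNIV"
  by (auto simp: orth_def B_simps)

lemma orth_UNIV: "orth B UNIV = {0}"
  using nondegenerate by (auto simp: orth_def B_simps symmetric)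

text \<open>The sum \<open>?Q\<close> contains both orthogonal spaces, so its own orthogonal space
  lies in \<open>V\<close> and in \<open>W\<close>. Taking orthogonal spaces once more turns this
  around, without counting dimensions.\<close>

lemma orth_Int_subset:
  assumes V: "subspace V" and W: "subspace W"
  shows "orth B (V \<inter> W) \<subseteq> {x + y |x y. x \<in> orth B V \<and> y \<in> orth B W}"
proof -
  let ?Q = "{x + y |x y. x \<in> orth B V \<and> y \<in> orth B W}"
  have Q: "subspace ?Q" by (intro subspace_sums) simp_all
  have "orth B V \<subseteq> ?Q"
  proof
    fix x assume "x \<in> orth B V"
    then show "x \<in> ?Q" using subspace_0[OF subspace_orth[of W]]
      by (intro CollectI exI[of _ x] exI[of _ 0]) simp
  qed
  moreover have "orth B W \<subseteq> ?Q"
  proof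
    fix x assume "x \<in> orth B W"
    then show "x \<in> ?Q" using subspace_0[OF subspace_orth[of V]]
      by (intro CollectI exI[of _ 0] exI[of _ x]) simp
  qed
  ultimately have "orth B ?Q \<subseteq> V \<inter> W"
    using orth_subset_iff[OF V Q] orth_subset_iff[OF W Q] by simp
  then show ?thesis using orth_subset_iff[OF subspace_inter[OF V W] Q] by simp
qed

lemma orth_direct_complement:
  assumes W: "subspace W" and "W \<inter> orth B W = {0}"
  shows "{x + y |x y. x \<in> W \<and> y \<in> orth B W} = UNIV"
  using orth_Int_subset[of "orth B W" W] assms by (simp add: orth_orth orth_zero Int_commute top_le)

section \<open>Invariance and orthogonal spaces of ideals\<close>

text \<open>Invariance exchanges an argument \<open>x\<close> of the bracket with the vector
  \<open>z\<close> it is paired with; \<open>ws\<close> collects the remaining arguments. As only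
  vanishing is compared, all signs and positions disappear.\<close>

lemma invariant_mset:
  assumes "length xs = n" "mset xs = mset (x # ws)" "mset ys = mset (z # ws)"
  shows "B (br xs) z = 0 \<longleftrightarrow> B (br ys) x = 0"
proof -
  have len: "length ws = n - 1" "length ys = n"
    using mset_eq_length[OF assms(2)] mset_eq_length[OF assms(3)] assms(1) by simp_all
  have neg: "B (- u) v = - B u v" for u v
    by (rule module_hom.neg[OF module_hom_B_left])
  have "B (br xs) z = 0 \<longleftrightarrow> B (br (ws @ [x])) z = 0"
    using br_mset[OF assms(1), of "ws @ [x]"] assms(2) neg by auto
  also have "\<dots> \<longleftrightarrow> B (br (ws @ [z])) x = 0"
    unfolding invariant[OF len(1), of x z] by (rule neg_equal_0_iff_equal)
  also have "\<dots> \<longleftrightarrow> B (br ys) x = 0"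
    using br_mset[OF len(2), of "ws @ [z]"] assms(3) neg by auto
  finally show ?thesis .
qed

lemma ideal_orth:
  assumes I: "ideal I" shows "ideal (orth B I)"
  unfolding ideal_in_iff
proof (intro conjI allI impI)
  fix x and ys :: "'a list" assume x: "x \<in> orth B I" and ys: "length ys = n - 1"
  have "B w (br (x # ys)) = 0" if w: "w \<in> I" for w
  proof -
    have "br (w # ys) \<in> I" using I w ys unfolding ideal_in_iff by simp
    then have "B (br (w # ys)) x = 0" using x by (simp add: orth_def)
    then have "B (br (x # ys)) w = 0"
      using invariant_mset[of "x # ys" x ys "w # ys" w] ys arity by simp
    then show ?thesis by (simp add: symmetric)
  qed
  then show "br (x # ys) \<in> orth B I" by (simp add: orth_def)
qed simp_all

text \<open>For arbitrary \<open>y\<close>, the bracket of \<open>y, v, zs\<close> lies in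
  \<open>I\<close> and so is orthogonal to \<open>x\<close>. Exchanging \<open>x\<close> and
  \<open>y\<close> shows that the bracket of \<open>x, v, zs\<close> is orthogonal to
  everything.\<close>

lemma orth_centralizes:
  assumes I: "ideal I" shows "orth B I \<subseteq> centralizer I"
proof
  fix x assume x: "x \<in> orth B I"
  have "br (x # v # zs) = 0" if v: "v \<in> I" and zs: "length zs = n - 2" for v zs
  proof (rule nondegenerate, rule allI)
    fix y
    have len: "length (v # zs) = n - 1" "length (x # v # zs) = n"
      "length (y # v # zs) = n"
      using zs arity by simp_all
    have "br (y # v # zs) \<in> I" using ideal_in_br[OF I len(3)] v by simp
    then have "B (br (y # v # zs)) x = 0" using x by (simp add: orth_def)
    then show "B (br (x # v # zs)) y = 0"
      using invariant_mset[OF len(2), of x "v # zs" "y # v # zs" y] by simp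
  qed
  then show "x \<in> centralizer I" by (simp add: centralizer_iff)
qed

text \<open>Pairing the bracket of \<open>x, v, zs\<close> with \<open>z\<close> vanishes exactly
  when pairing the bracket of \<open>v, z, zs\<close> with \<open>x\<close> does; nondegeneracy
  turns vanishing for all \<open>z\<close> into vanishing of the first bracket.\<close>

lemma centralizer_eq_orth:
  "centralizer V = orth B (bracket_span (V # replicate (n - 1) UNIV))"
proof (intro subset_antisym subsetI)
  fix x assume x: "x \<in> centralizer V"
  have "bracket_span (V # replicate (n - 1) UNIV) \<subseteq> {w. B w x = 0}"
  proof (subst bracket_span_Cons_subset_iff)
    show "subspace {w. B w x = 0}"
      by (rule module_hom.subspace_kernel[OF module_hom_B_left])
    show "\<forall>v ys. v \<in> V \<longrightarrow> length ys = n - 1 \<longrightarrow> set ys \<subseteq> UNIV \<longrightarrow> br (v # ys) \<in> {w. B w x = 0}"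
    proof (intro allI impI CollectI)
      fix v and ys :: "'a list" assume v: "v \<in> V" and ys: "length ys = n - 1"
      obtain z zs where zs: "ys = z # zs" using ys arity by (cases ys) auto
      have "br (x # v # zs) = 0"
        using x v ys unfolding centralizer_iff zs by simp
      then have "B (br (x # v # zs)) z = 0" by (simp add: B_simps)
      then show "B (br (v # ys)) x = 0"
        using invariant_mset[of "x # v # zs" x "v # zs" "v # ys" z] ys zs arity
        by (simp add: add_mset_commute)
    qed
  qed
  then show "x \<in> orth B (bracket_span (V # replicate (n - 1) UNIV))"
    by (auto simp: orth_def)
next
  fix x assume x: "x \<in> orth B (bracket_span (V # replicate (n - 1) UNIV))"
  have "br (x # v # zs) = 0" if v: "v \<in> V" and zs: "length zs = n - 2" for v zs
  proof (rule nondegenerate, rule allI)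
    fix z
    have "br (v # z # zs) \<in> bracket_span (V # replicate (n - 1) UNIV)"
      using v zs arity by (intro br_mem_bracket_span) (simp add: list_all2_mem_replicate)
    then have "B (br (v # z # zs)) x = 0" using x by (simp add: orth_def)
    then show "B (br (x # v # zs)) z = 0"
      using invariant_mset[of "x # v # zs" x "v # zs" "v # z # zs" z] zs arity
      by (simp add: add_mset_commute)
  qed
  then show "x \<in> centralizer V" by (simp add: centralizer_iff)
qed

lemma center_eq_orth: "center = orth B (bracket_span (replicate n UNIV))"
proof -
  have "replicate n UNIV = UNIV # replicate (n - 1) (UNIV :: 'a set)"
    using arity by (cases n) simp_all
  then show ?thesis unfolding center_def centralizer_eq_orth by simp
qed

section \<open>Minimal ideals outside the radical\<close>

text \<open>If \<open>M\<close> were contained in \<open>orth B M\<close>, it would be abelian and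
  lie in \<open>R\<close>. So by minimality the two meet in zero and together span the algebra. As
  \<open>orth B M\<close> acts trivially on \<open>M\<close>, ideals of \<open>M\<close> are ideals
  of the whole algebra, and minimality becomes simplicity.\<close>

lemma minimal_ideal_simple:
  assumes R: "is_radical R" and M: "ideal M" "\<not> M \<subseteq> R"
    and minimal: "\<And>I. ideal I \<Longrightarrow> I \<subseteq> M \<Longrightarrow> I = {0} \<or> I = M"
  shows "simple M"
proof -
  have sM: "subspace M" using M(1) by (rule ideal_in_subspace)
  have nab: "bracket_span (replicate n M) \<noteq> {0}"
    using abelian_ideal_subset_radical[OF R M(1)] M(2) by blast
  have vanish: "br xs = 0"
    if "length xs = n" "x \<in> M" "y \<in> orth B M" "mset xs = mset (y # x # zs)" for xs x y zs
  proof -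
    have "length zs = n - 2" using mset_eq_length[OF that(4)] that(1) by simp
    moreover have "y \<in> centralizer M" using orth_centralizes[OF M(1)] that(3) by blast
    ultimately have "br (y # x # zs) = 0" using that(2) by (simp add: centralizer_iff)
    then show ?thesis using br_mset[OF that(1,4)] by auto
  qed
  have "M \<inter> orth B M = {0}"
  proof -
    have "M \<inter> orth B M \<noteq> M"
    proof
      assume "M \<inter> orth B M = M"
      then have sub: "M \<subseteq> orth B M" by blast
      have "br xs = 0" if xs: "length xs = n" "set xs \<subseteq> M" for xs
      proof -
        obtain y x zs where "xs = y # x # zs"
          using xs arity by (cases xs; cases "tl xs") auto
        then show ?thesis using vanish[of xs x y zs] xs sub by auto
      qed
      then have "bracket_span (replicate n M) \<subseteq> {0}"
        by (subst bracket_span_replicate_subset_iff) auto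
      then show False using nab subspace_0[OF subspace_bracket_span] by blast
    qed
    moreover have "ideal (M \<inter> orth B M)"
      using M(1) ideal_orth[OF M(1)] unfolding ideal_in_iff by (auto intro: subspace_inter)
    ultimately show ?thesis using minimal by blast
  qed
  then have decomp: "{x + y |x y. x \<in> M \<and> y \<in> orth B M} = UNIV"
    by (rule orth_direct_complement[OF sM])
  have "ideal I" if I: "ideal_in M I" for I
    unfolding ideal_in_iff
  proof (intro conjI allI impI)
    fix x and ys :: "'a list" assume x: "x \<in> I" and ys: "length ys = n - 1"
    have xM: "x \<in> M" using I x by (auto simp: ideal_in_def)
    have sI: "subspace I" using I by (rule ideal_in_subspace)
    \<comment> \<open>The entries of \<open>ys\<close> are split along \<open>M\<close> and
      \<open>orth B M\<close>: those from \<open>M\<close> keep the bracket in \<open>I\<close>, and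
      a single one from \<open>orth B M\<close> kills it.\<close>
    have "br ([x] @ ys) \<in> I"
    proof (rule br_sum_expand[OF sI, where A = M and D = "orth B M"])
      fix ps assume ps: "length ([x] @ ps) = n" "set ps \<subseteq> M"
      then show "br ([x] @ ps) \<in> I" using I x unfolding ideal_in_iff by auto
    next
      fix ps assume ps: "length ([x] @ ps) = n" "set ps \<inter> orth B M \<noteq> {}"
      then obtain y where y: "y \<in> set ps" "y \<in> orth B M" by blast
      then have "br ([x] @ ps) = 0"
        using ps by (intro vanish[OF _ xM y(2), of _ "remove1 y ps"]) (auto simp: add_mset_commute)
      then show "br ([x] @ ps) \<in> I" using subspace_0[OF sI] by simp
    qed (use decomp ys arity in auto)
    then show "br (x # ys) \<in> I" by simp
  qed (use I ideal_in_subspace in auto)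
  then show ?thesis
    unfolding simple_def using nab minimal by (auto simp: ideal_in_def)
qed

section \<open>Centralizer of the radical and action of the Levi factor\<close>

text \<open>Central elements are orthogonal to the derived algebra, which contains the perfect
  \<open>S\<close>. Orthogonality to \<open>R\<close> as well leaves only zero.\<close>

lemma levi_orth_radical_Int_center:
  assumes "levi_decomposition S R"
  shows "center \<inter> orth B R = {0}"
proof -
  have S: "strong_semisimple S" and SR: "direct_sum S R UNIV"
    using assms by (auto simp: levi_decomposition_def)
  have "x = 0" if x: "x \<in> center" "x \<in> orth B R" for x
  proof -
    have "B y x = 0" for y
    proof -
      obtain s r where sr: "s \<in> S" "r \<in> R" "y = s + r"
        using SR UNIV_I[of y] unfolding direct_sum_def by blast
      have "s \<in> bracket_span (replicate n UNIV)"
        using strong_semisimple_subset_derived[OF S] bracket_span_mono[of S UNIV] sr(1) by blast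
      then have "B s x = 0" using x(1) by (simp add: center_eq_orth orth_def)
      moreover have "B r x = 0" using x(2) sr(2) by (simp add: orth_def)
      ultimately show ?thesis by (simp add: sr(3) B_simps)
    qed
    then show ?thesis using nondegenerate symmetric by metis
  qed
  then show ?thesis
    using subspace_0[OF subspace_orth] subspace_0[OF subspace_centralizer]
    unfolding center_def by blast
qed

text \<open>The derived algebra lies in \<open>S + ?T\<close> with \<open>?T\<close> inside
  \<open>R\<close>, so an element of it that is in \<open>R\<close> has \<open>S\<close>-component
  zero.\<close>

lemma levi_derived_Int_radical:
  assumes "levi_decomposition S R"
  shows "bracket_span (replicate n UNIV) \<inter> R \<subseteq> bracket_span (R # replicate (n - 1) UNIV)"
    (is "_ \<subseteq> ?T")
proof
  fix x assume x: "x \<in> bracket_span (replicate n UNIV) \<inter> R"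
  have S: "subalgebra S" and iR: "ideal R" and SR: "direct_sum S R UNIV"
    using assms by (auto simp: levi_decomposition_def is_radical_def)
  have sS: "subspace S" using S by (simp add: subalgebra_def)
  have sR: "subspace R" using iR by (rule ideal_in_subspace)
  have T: "?T \<subseteq> R" using iR by (simp add: ideal_in_def)
  let ?V = "{s + t |s t. s \<in> S \<and> t \<in> ?T}"
  have V: "subspace ?V" using sS by (intro subspace_sums) simp_all
  have SV: "s \<in> ?V" if "s \<in> S" for s
    using that subspace_0[OF subspace_bracket_span]
    by (intro CollectI exI[of _ s] exI[of _ 0]) simp
  have TV: "t \<in> ?V" if "t \<in> ?T" for t
    using that subspace_0[OF sS] by (intro CollectI exI[of _ 0] exI[of _ t]) simp
  have "bracket_span (replicate n UNIV) \<subseteq> ?V"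
  proof (subst bracket_span_replicate_subset_iff[OF V], intro allI impI)
    fix xs :: "'a list" assume xs: "length xs = n"
    have "br ([] @ xs) \<in> ?V"
    proof (rule br_sum_expand[OF V, where A = S and D = R])
      fix ps assume "length ([] @ ps) = n" "set ps \<subseteq> S"
      then have "br ps \<in> S"
        using S bracket_span_replicate_subset_iff[OF sS] unfolding subalgebra_def by simp
      then show "br ([] @ ps) \<in> ?V" using SV by simp
    next
      fix ps assume ps: "length ([] @ ps) = n" "set ps \<inter> R \<noteq> {}"
      then obtain r where r: "r \<in> set ps" "r \<in> R" by blast
      have "br (r # remove1 r ps) \<in> ?T"
        using ps r by (intro br_mem_bracket_span) (simp add: list_all2_mem_replicate length_remove1)
      then have "br ps \<in> ?T"
        using ps r by (intro br_mset_mem[of ps "r # remove1 r ps"]) simp_all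
      then show "br ([] @ ps) \<in> ?V" using TV by simp
    qed (use SR xs in \<open>auto simp: direct_sum_def\<close>)
    then show "br xs \<in> ?V" by simp
  qed
  with x obtain s t where st: "s \<in> S" "t \<in> ?T" "x = s + t" by blast
  then have "s = x - t" by simp
  then have "s \<in> R" using x T st(2) sR by (auto intro: subspace_diff)
  then have "s = 0" using SR st(1) unfolding direct_sum_def by blast
  then show "x \<in> ?T" using st by simp
qed

lemma levi_centralizer:
  assumes "levi_decomposition S R"
  shows "direct_sum center (orth B R) (centralizer R)"
proof -
  have iR: "ideal R" using assms by (simp add: levi_decomposition_def is_radical_def)
  have "center \<subseteq> centralizer R"
    unfolding center_def by (auto simp: centralizer_iff)
  then have "{x + y |x y. x \<in> center \<and> y \<in> orth B R} \<subseteq> centralizer R"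
    using orth_centralizes[OF iR] subspace_add[OF subspace_centralizer] by blast
  \<comment> \<open>Taking orthogonal spaces in \<open>levi_derived_Int_radical\<close> reverses the
    inclusion, and the orthogonal space of the intersection splits into the center and
    \<open>orth B R\<close>.\<close>
  moreover have "centralizer R \<subseteq> {x + y |x y. x \<in> center \<and> y \<in> orth B R}"
    using orth_antimono[OF levi_derived_Int_radical[OF assms]]
      orth_Int_subset[OF subspace_bracket_span ideal_in_subspace[OF iR], of "replicate n UNIV"]
    unfolding centralizer_eq_orth[of R] center_eq_orth by blast
  ultimately show ?thesis
    unfolding direct_sum_def using levi_orth_radical_Int_center[OF assms] by blast
qed

lemma levi_bracket_orth_radical:
  assumes "levi_decomposition S R"
  shows "bracket_span (replicate (n - 1) S @ [orth B R]) = orth B R"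
proof
  let ?W = "bracket_span (replicate (n - 1) S @ [orth B R])"
  have S: "subalgebra S" "strong_semisimple S" and iR: "ideal R" and SR: "direct_sum S R UNIV"
    using assms by (auto simp: levi_decomposition_def is_radical_def)
  have sS: "subspace S" using S by (simp add: subalgebra_def)
  have sR: "subspace R" using iR by (rule ideal_in_subspace)
  have mem: "list_all2 (\<in>) xs (replicate (n - 1) S @ [orth B R]) \<longleftrightarrow>
      (\<exists>ys y. xs = ys @ [y] \<and> length ys = n - 1 \<and> set ys \<subseteq> S \<and> y \<in> orth B R)" for xs
    by (auto simp: list_all2_snoc list_all2_mem_replicate)
  show "?W \<subseteq> orth B R"
  proof (subst bracket_span_subset_iff[OF subspace_orth], unfold mem, clarify)
    fix y and ys :: "'a list"
    assume "length ys = n - 1" "y \<in> orth B R"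
    then show "br (ys @ [y]) \<in> orth B R"
      using arity by (intro ideal_in_br[OF ideal_orth[OF iR]]) auto
  qed
  \<comment> \<open>The remaining inclusion is proved in its dual form.\<close>
  have "orth B ?W \<subseteq> R"
  proof
    fix x assume x: "x \<in> orth B ?W"
    obtain s r where sr: "s \<in> S" "r \<in> R" "x = s + r"
      using SR UNIV_I[of x] unfolding direct_sum_def by blast
    have "s = 0"
    proof (rule strong_semisimple_center[OF S(2) sr(1)])
      fix ys assume ys: "length ys = n - 1" "set ys \<subseteq> S"
      have len: "length (x # ys) = n" "length (s # ys) = n" using ys arity by simp_all
      have "B y (br (x # ys)) = 0" if y: "y \<in> orth B R" for y
      proof -
        have "br (ys @ [y]) \<in> ?W"
          by (rule br_mem_bracket_span, unfold mem) (use ys y in blast)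
        then have "B (br (ys @ [y])) x = 0" using x by (simp add: orth_def)
        then have "B (br (x # ys)) y = 0"
          using invariant_mset[OF len(1), of x ys "ys @ [y]" y] by simp
        then show ?thesis by (simp add: symmetric)
      qed
      \<comment> \<open>Being orthogonal to \<open>orth B R\<close> means lying in \<open>R\<close>.
        Removing the \<open>R\<close>-component of \<open>x\<close> then puts the bracket of
        \<open>s\<close> with \<open>ys\<close> into both \<open>S\<close> and
        \<open>R\<close>.\<close>
      then have "br (x # ys) \<in> R"
        using orth_orth[OF sR] by (auto simp: orth_def)
      moreover have "br (r # ys) \<in> R" using iR sr ys by (simp add: ideal_in_iff)
      moreover have "br (x # ys) = br (s # ys) + br (r # ys)"
        using module_hom.add[OF module_hom_br_head[OF ys(1)]] sr(3) by simp
      ultimately have "br (s # ys) \<in> R"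
        using subspace_diff[OF sR, of "br (x # ys)" "br (r # ys)"] by simp
      moreover have "br (s # ys) \<in> S"
        using S(1) len(2) sr(1) ys bracket_span_replicate_subset_iff[OF sS, of S]
        unfolding subalgebra_def by simp
      ultimately show "br (s # ys) = 0" using SR unfolding direct_sum_def by blast
    qed
    then show "x \<in> R" using sr by simp
  qed
  then show "orth B R \<subseteq> ?W"
    using orth_subset_iff[OF subspace_bracket_span sR] by simp
qed

section \<open>Coisotropy of the radical\<close>

lemma coisotropic_no_strong_semisimple_ideal:
  assumes "levi_decomposition S R" and coiso: "orth B R \<subseteq> R"
    and I: "ideal I" "strong_semisimple I"
  shows "I = {0}"
proof -
  have R: "ideal R" "solvable R"
    using assms(1) by (auto simp: levi_decomposition_def is_radical_def)
  have sI: "subspace I" using I(1) by (rule ideal_in_subspace)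
  have "ideal_in I (R \<inter> I)" by (rule ideal_Int[OF R(1) I(1)]) simp
  moreover have "solvable (R \<inter> I)"
    using solvable_subset[OF R(2), of "R \<inter> I"] calculation ideal_in_subspace by blast
  ultimately have RI: "R \<inter> I = {0}" by (rule strong_semisimple_solvable_ideal[OF I(2)])
  have "I \<subseteq> centralizer R"
  proof
    fix x assume x: "x \<in> I"
    have "br (x # v # zs) = 0" if "v \<in> R" "length zs = n - 2" for v zs
    proof -
      have len: "length (x # v # zs) = n" using that arity by simp
      have "br (x # v # zs) \<in> R \<inter> I"
        using ideal_in_br[OF R(1) len] ideal_in_br[OF I(1) len] x that by simp
      then show ?thesis using RI by simp
    qed
    then show "x \<in> centralizer R" by (simp add: centralizer_iff)
  qed
  then have cent: "I \<subseteq> {x + y |x y. x \<in> center \<and> y \<in> orth B R}"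
    using levi_centralizer[OF assms(1)] by (simp add: direct_sum_def)
  \<comment> \<open>Elements of \<open>I\<close> lie in \<open>orth B R\<close> only up to a central
    summand, which disappears once a bracket is taken; perfectness of \<open>I\<close> then recovers
    \<open>I\<close> itself.\<close>
  have "bracket_span (replicate n I) \<subseteq> orth B R"
  proof (subst bracket_span_replicate_subset_iff[OF subspace_orth], intro allI impI)
    fix xs assume xs: "length xs = n" "set xs \<subseteq> I"
    then obtain x ys where xys: "xs = x # ys" using arity by (cases xs) auto
    then have "x \<in> I" using xs by simp
    then have "x \<in> {x + y |x y. x \<in> center \<and> y \<in> orth B R}" using cent by (rule subsetD[rotated])
    then obtain c y where cy: "c \<in> center" "y \<in> orth B R" "x = c + y" by blast
    have ys: "length ys = n - 1" using xs xys by simp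
    have "br xs = br (c # ys) + br (y # ys)"
      using module_hom.add[OF module_hom_br_head[OF ys]] cy(3) xys by simp
    moreover have "br (c # ys) = 0" using cy(1) ys by (simp add: center_iff)
    moreover have "br (y # ys) \<in> orth B R"
      using ideal_orth[OF R(1)] cy(2) ys by (simp add: ideal_in_iff)
    ultimately show "br xs \<in> orth B R" by simp
  qed
  then have "I \<subseteq> R" using strong_semisimple_subset_derived[OF I(2)] coiso by blast
  then show ?thesis using RI by blast
qed

text \<open>The span of the chosen summands is an ideal of \<open>S\<close>; adding \<open>R\<close>
  absorbs every bracket with an entry from \<open>R\<close>.\<close>

lemma levi_ideal_summands:
  assumes "levi_decomposition S R" and \<J>: "simple_summands \<J> S" "\<K> \<subseteq> \<J>"
  shows "ideal {x + y |x y. x \<in> span (\<Union>\<K>) \<and> y \<in> R}" (is "ideal ?H")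
proof -
  let ?K = "span (\<Union>\<K>)"
  have S: "subalgebra S" and iR: "ideal R" and SR: "direct_sum S R UNIV"
    using assms by (auto simp: levi_decomposition_def is_radical_def)
  have sS: "subspace S" using S by (simp add: subalgebra_def)
  have sR: "subspace R" using iR by (rule ideal_in_subspace)
  have H: "subspace ?H" using sR by (intro subspace_sums) simp_all
  have iK: "ideal_in S ?K"
    using \<J> by (intro ideal_in_span_Union[OF _ sS]) (auto simp: simple_summands_def)
  have KH: "x \<in> ?H" if "x \<in> ?K" for x
    using that subspace_0[OF sR] by (intro CollectI exI[of _ x] exI[of _ 0]) simp
  have RH: "x \<in> ?H" if "x \<in> R" for x
    using that span_zero by (intro CollectI exI[of _ 0] exI[of _ x]) simp
  show ?thesis
    unfolding ideal_in_iff
  proof (intro conjI allI impI)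
    fix z and ys :: "'a list" assume z: "z \<in> ?H" and ys: "length ys = n - 1"
    from z obtain x y where xy: "x \<in> ?K" "y \<in> R" "z = x + y" by blast
    have "br ([x] @ ys) \<in> ?H"
    proof (rule br_sum_expand[OF H, where A = S and D = R])
      fix ps assume "length ([x] @ ps) = n" "set ps \<subseteq> S"
      then have "br (x # ps) \<in> ?K" using iK xy(1) by (auto simp: ideal_in_iff)
      then show "br ([x] @ ps) \<in> ?H" using KH by simp
    next
      fix ps assume "length ([x] @ ps) = n" "set ps \<inter> R \<noteq> {}"
      then have "br ([x] @ ps) \<in> R" by (intro ideal_in_br[OF iR]) auto
      then show "br ([x] @ ps) \<in> ?H" by (rule RH)
    qed (use SR ys arity in \<open>auto simp: direct_sum_def\<close>)
    moreover have "br (y # ys) \<in> ?H" using iR xy(2) ys by (intro RH) (simp add: ideal_in_iff)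
    moreover have "br (z # ys) = br (x # ys) + br (y # ys)"
      using module_hom.add[OF module_hom_br_head[OF ys]] xy(3) by simp
    ultimately show "br (z # ys) \<in> ?H" using subspace_add[OF H] by simp
  qed (use H in simp_all)
qed

text \<open>The algebra is \<open>J + ?H\<close>, and an ideal \<open>N\<close> above
  \<open>?H\<close> meets the simple \<open>J\<close> in zero or in \<open>J\<close>, so
  \<open>N\<close> is \<open>?H\<close> or everything. Orthogonality turns this maximality of
  \<open>?H\<close> into minimality of \<open>orth B ?H\<close>.\<close>

lemma levi_simple_ideal:
  assumes levi: "levi_decomposition S R" and \<J>: "simple_summands \<J> S" and J: "J \<in> \<J>"
    and outside: "\<not> orth B R \<subseteq> {x + y |x y. x \<in> span (\<Union>(\<J> - {J})) \<and> y \<in> R}"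
      (is "\<not> _ \<subseteq> ?H")
  shows "ideal (orth B ?H) \<and> simple (orth B ?H)"
proof -
  let ?K = "span (\<Union>(\<J> - {J}))"
  have S: "subalgebra S" and rad: "is_radical R" and SR: "direct_sum S R UNIV"
    using levi by (auto simp: levi_decomposition_def)
  have iR: "ideal R" using rad by (simp add: is_radical_def)
  have sR: "subspace R" using iR by (rule ideal_in_subspace)
  have iH: "ideal ?H" using levi_ideal_summands[OF levi \<J>] by blast
  have sH: "subspace ?H" using iH by (rule ideal_in_subspace)
  have iJ: "ideal_in S J" "simple J" using \<J> J by (auto simp: simple_summands_def)
  have sJ: "subspace J" using iJ(1) by (rule ideal_in_subspace)
  have decomp: "\<exists>u h. u \<in> J \<and> h \<in> ?H \<and> x = u + h" for x
  proof -
    obtain s r where sr: "s \<in> S" "r \<in> R" "x = s + r"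
      using SR UNIV_I[of x] unfolding direct_sum_def by blast
    have "\<Union>\<J> = J \<union> \<Union>(\<J> - {J})" using J by blast
    then have "s \<in> span (J \<union> \<Union>(\<J> - {J}))" using sr(1) \<J> by (simp add: simple_summands_def)
    moreover have "span J = J" using sJ by simp
    ultimately obtain u v where uv: "u \<in> J" "v \<in> ?K" "s = u + v"
      unfolding span_Un by auto
    then have "v + r \<in> ?H" "x = u + (v + r)" using sr by (auto simp: add.assoc)
    then show ?thesis using uv(1) by blast
  qed
  have maximal: "N = ?H \<or> N = UNIV" if N: "ideal N" "?H \<subseteq> N" for N
  proof -
    have sN: "subspace N" using N(1) by (rule ideal_in_subspace)
    have "ideal_in J (N \<inter> J)" by (rule ideal_Int[OF N(1) iJ(1)]) simp
    then consider "N \<inter> J = {0}" | "N \<inter> J = J" using iJ(2) unfolding simple_def by blast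
    then show ?thesis
    proof cases
      case 1
      have "x \<in> ?H" if x: "x \<in> N" for x
      proof -
        obtain u h where uh: "u \<in> J" "h \<in> ?H" "x = u + h" using decomp by blast
        then have "u = x - h" by simp
        then have "u \<in> N" using N(2) x uh(2) subspace_diff[OF sN] by blast
        then have "u = 0" using 1 uh(1) by blast
        then show ?thesis using uh by simp
      qed
      then show ?thesis using N(2) by blast
    next
      case 2
      have "x \<in> N" for x
      proof -
        obtain u h where uh: "u \<in> J" "h \<in> ?H" "x = u + h" using decomp by blast
        have "u \<in> N" using 2 uh(1) by blast
        moreover have "h \<in> N" using N(2) uh(2) by (rule subsetD)
        ultimately show ?thesis unfolding uh(3) by (rule subspace_add[OF sN])
      qed
      then show ?thesis by blast
    qed
  qed
  have iM: "ideal (orth B ?H)" using iH by (rule ideal_orth)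
  moreover have "simple (orth B ?H)"
  proof (rule minimal_ideal_simple[OF rad iM])
    show "\<not> orth B ?H \<subseteq> R" using outside orth_subset_iff[OF sH sR] by simp
    fix I assume I: "ideal I" "I \<subseteq> orth B ?H"
    have sI: "subspace I" using I(1) by (rule ideal_in_subspace)
    have "?H \<subseteq> orth B I" using orth_antimono[OF I(2)] orth_orth[OF sH] by simp
    then have "orth B I = ?H \<or> orth B I = UNIV" by (rule maximal[OF ideal_orth[OF I(1)]])
    then have "orth B (orth B I) = orth B ?H \<or> orth B (orth B I) = {0}"
      by (auto simp only: orth_UNIV)
    then show "I = {0} \<or> I = orth B ?H" unfolding orth_orth[OF sI] by blast
  qed
  ultimately show ?thesis by blast
qed

text \<open>For each \<open>J\<close>, an element of \<open>orth B R\<close> lies in the sum of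
  \<open>R\<close> and the summands other than \<open>J\<close>. Uniqueness of the Levi components
  places its \<open>S\<close>-component \<open>s\<close> in the span of those summands; as
  \<open>J\<close> varies, independence gives \<open>s = 0\<close>.\<close>

lemma no_strong_semisimple_ideal_coisotropic:
  assumes levi: "levi_decomposition S R"
    and no: "\<And>I. ideal I \<Longrightarrow> strong_semisimple I \<Longrightarrow> I = {0}"
  shows "orth B R \<subseteq> R"
proof
  fix x assume x: "x \<in> orth B R"
  have SR: "direct_sum S R UNIV" and "strong_semisimple S"
    using levi by (auto simp: levi_decomposition_def)
  then obtain \<J> where \<J>: "simple_summands \<J> S" using strong_semisimple_iff by blast
  obtain s r where sr: "s \<in> S" "r \<in> R" "x = s + r"
    using SR UNIV_I[of x] unfolding direct_sum_def by blast
  have iR: "ideal R" using levi by (simp add: levi_decomposition_def is_radical_def)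
  have sR: "subspace R" using iR by (rule ideal_in_subspace)
  have "s = 0"
  proof (rule simple_summands_Int[OF \<J> sr(1)])
    fix J assume J: "J \<in> \<J>"
    let ?K = "span (\<Union>(\<J> - {J}))"
    let ?H = "{x + y |x y. x \<in> ?K \<and> y \<in> R}"
    have "orth B R \<subseteq> ?H"
    proof (rule ccontr)
      assume "\<not> orth B R \<subseteq> ?H"
      then have "ideal (orth B ?H)" "simple (orth B ?H)"
        using levi_simple_ideal[OF levi \<J> J] by blast+
      moreover from this have "orth B ?H = {0}"
        using no simple_imp_strong_semisimple by blast
      \<comment> \<open>The zero space is not simple, since a simple algebra equals its nonzero
        derived algebra.\<close>
      ultimately show False using simple_perfect unfolding simple_def by metis
    qed
    then obtain v q where vq: "v \<in> ?K" "q \<in> R" "x = v + q" using x by blast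
    have "?K \<subseteq> span (\<Union>\<J>)" by (intro span_mono) blast
    then have "v \<in> S" using vq(1) \<J> by (auto simp: simple_summands_def)
    moreover have "subspace S" using levi by (simp add: levi_decomposition_def subalgebra_def)
    ultimately have "s - v \<in> S" using sr(1) by (intro subspace_diff)
    moreover have "s - v = q - r" using sr(3) vq(3) by (simp add: algebra_simps)
    moreover have "q - r \<in> R" using sr(2) vq(2) sR by (intro subspace_diff)
    ultimately have "s - v \<in> S \<inter> R" by simp
    then have "s - v = 0" using SR unfolding direct_sum_def by blast
    then show "s \<in> ?K" using vq(1) by simp
  qed
  then show "x \<in> R" using sr by simp
qed

end

theorem theorem3p5:
  fixes scale :: "complex \<Rightarrow> 'a::ab_group_add \<Rightarrow> 'a"
    and n :: nat
    and br :: "'a list \<Rightarrow> 'a"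
    and B :: "'a \<Rightarrow> 'a \<Rightarrow> complex"
    and S R :: "'a set"
  assumes "metric_n_lie_algebra scale n br B"
    and "n_lie_algebra.levi_decomposition scale n br S R"
  shows "(\<not> (\<exists>I. n_lie_algebra.ideal scale n br I \<and> I \<noteq> {0} \<and>
              n_lie_algebra.strong_semisimple scale n br I)
            \<longleftrightarrow> orth B R \<subseteq> R)
    \<and> direct_sum (n_lie_algebra.center scale n br) (orth B R)
        (n_lie_algebra.centralizer scale n br R)
    \<and> n_lie_algebra.bracket_span scale br (replicate (n - 1) S @ [orth B R]) = orth B R"
proof -
  interpret metric_n_lie_algebra scale n br B by fact
  show ?thesis
    using levi_centralizer[OF assms(2)] levi_bracket_orth_radical[OF assms(2)]
      coisotropic_no_strong_semisimple_ideal[OF assms(2)]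
      no_strong_semisimple_ideal_coisotropic[OF assms(2)]
    by blast
qed

end
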